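(* Let $a, b, n \in \mathbb{N}$ with $\gcd(a,b) = 1$. If $a^n \equiv 0 \pmod{|a-b|}$ or $b^n \equiv 0 \pmod{|a-b|}$, then $|a-b| = 1$.
   Context: $\mathbb{N}$ denotes the set of positive integers. The congruence $m \equiv 0 \pmod{k}$ means that $k$ divides $m$ (and $0$ divides only $0$). *)

theory Defs
  imports "HOL-Number_Theory.Cong"
begin

end

theory Submission
  imports Defs
begin

text \<open>Subtracting \<open>b\<close> from \<open>a\<close> does not change the gcd with
  \<open>b\<close>, so \<open>a - b\<close> is coprime to \<open>a\<close> and to \<open>b\<close>,
  hence to their powers. A number dividing something coprime to it is a unit.\<close>

theorem lemma1:
  fixes a b n :: nat
  assumes "a > 0" and "b > 0" and "n > 0"
    and "gcd a b = 1"
    and "[int a ^ n = 0] (mod \<bar>int a - int b\<bar>) \<or> [int b ^ n = 0] (mod \<bar>int a - int b\<bar>)"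
  shows "\<bar>int a - int b\<bar> = 1"
proof -
  let ?d = "int a - int b"
  have "coprime (int a) (int b)"
    using assms(4) by (simp add: coprime_iff_gcd_eq_1)
  \<comment> \<open>The second difference is reversed to fit \<open>gcd_diff1\<close>; its sign is
    flipped afterwards.\<close>
  then have "gcd ?d (int b) = 1" "gcd (int b - int a) (int a) = 1"
    by (metis gcd_diff1 coprime_iff_gcd_eq_1 coprime_commute)+
  then have "coprime ?d (int a)" "coprime ?d (int b)"
    by (metis coprime_iff_gcd_eq_1 coprime_minus_left_iff minus_diff_eq)+
  then have "coprime ?d (int a ^ n)" "coprime ?d (int b ^ n)"
    by simp_all
  moreover have "?d dvd int a ^ n \<or> ?d dvd int b ^ n"
    using assms(5) by (simp add: cong_0_iff)
  \<comment> \<open>\<open>?d\<close> is itself a common divisor of \<open>?d\<close> and one of the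
    powers; this covers \<open>?d = 0\<close> too.\<close>
  ultimately have "is_unit ?d"
    by (meson coprime_common_divisor dvd_refl)
  then show ?thesis
    by simp
qed

end
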